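(* Let $\Omega$ be a domain in $\mathbb{R}^{m+n}$, $m,n\geq 2$. Let $u:\Omega\to[0,+\infty)$ be such that (a) for each $y\in\mathbb{R}^n$ the function $\Omega(y)\ni x\mapsto u(x,y)\in[0,+\infty)$ is quasi-nearly subharmonic, (b) for each $x\in\mathbb{R}^m$ the function $\Omega(x)\ni y\mapsto u(x,y)\in[0,+\infty)$ is a $\lambda$-Harnack function, where $\lambda\in(0,1)$ is fixed. Then $u$ is quasi-nearly subharmonic in $\Omega$.
   Context: Points of $\mathbb{R}^{m+n}$ are written $(x,y)$ with $x\in\mathbb{R}^m$, $y\in\mathbb{R}^n$. For $\Omega\subset\mathbb{R}^{m+n}$ put $\Omega(y)=\{x\in\mathbb{R}^m:(x,y)\in\Omega\}$ and $\Omega(x)=\{y\in\mathbb{R}^n:(x,y)\in\Omega\}$. $m_N$ is Lebesgue measure on $\mathbb{R}^N$, $B^N(x,r)$ is the open ball with center $x$ and radius $r$, $\nu_N=m_N(B^N(0,1))$, and $u^+=\max\{u,0\}$. The definitions below are stated for a domain $D\subset\mathbb{R}^N$, $N\geq2$, and are applied verbatim on the open slices $\Omega(y)$ and $\Omega(x)$. A Lebesgue measurable function $u:D\to[-\infty,+\infty)$ is $K$-quasi-nearly subharmonic if $u^+\in\mathcal{L}^1_{\mathrm{loc}}(D)$ and if there is a constant $K=K(N,u,D)\geq1$ such that for all closed balls $\overline{B^N(x,r)}\subset D$ one has $$u_M(x)\leq\frac{K}{\nu_N r^N}\int_{B^N(x,r)}u_M(y)\,dm_N(y)$$ for all $M\geq0$,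 where $u_M:=\max\{u,-M\}+M$. A function $u:D\to[-\infty,+\infty)$ is quasi-nearly subharmonic if it is $K$-quasi-nearly subharmonic in $D$ for some $K\geq1$. For $D\neq\mathbb{R}^N$, a continuous function $u:D\to[0,+\infty)$ is a $\lambda$-Harnack function, $\lambda\in(0,1)$, if there is a constant $C_\lambda=C(\lambda)\geq1$ such that $$\max_{z\in\overline{B^N(x,\lambda r)}}u(z)\leq C_\lambda\min_{z\in\overline{B^N(x,\lambda r)}}u(z)$$ whenever $\overline{B^N(x,r)}\subset D$.
   Formalization: In (a) one constant K is required to serve all slices Ω(y). If K may vary with y the claim fails: take u(x,y)=|y|/(|y|²+|x|) on |x|<1, 0<|y|<1. In (b) the Harnack constant depends on λ only, the same for all slices. *)

theory Defs
  imports "HOL-Analysis.Analysis"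
begin

definition locally_integrable :: "'a::euclidean_space set \<Rightarrow> ('a \<Rightarrow> real) \<Rightarrow> bool" where
  "locally_integrable D f \<longleftrightarrow> (\<forall>S. compact S \<and> S \<subseteq> D \<longrightarrow> f absolutely_integrable_on S)"

definition truncation :: "real \<Rightarrow> ('a \<Rightarrow> ereal) \<Rightarrow> 'a \<Rightarrow> real" where
  "truncation M u z = real_of_ereal (max (u z) (ereal (- M)) + ereal M)"

(* real_of_ereal loses nothing in these definitions: functions on D take values in
   [-infinity, infinity), so the positive part and the truncation are finite there.
   They are nonnegative, and the local integrability of the positive part makes the
   Bochner integral over the ball the ordinary Lebesgue integral.
   D is not required to be connected or nonempty, since the notion is applied to slices of
   a domain; only the values of u on D matter. *)
definition K_quasi_nearly_subharmonic ::
    "real \<Rightarrow> 'a::euclidean_space set \<Rightarrow> ('a \<Rightarrow> ereal) \<Rightarrow> bool" where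
  "K_quasi_nearly_subharmonic K D u \<longleftrightarrow>
     K \<ge> 1 \<and>
     (\<forall>z\<in>D. u z < \<infinity>) \<and>
     u \<in> borel_measurable (lebesgue_on D) \<and>
     locally_integrable D (\<lambda>z. real_of_ereal (max (u z) 0)) \<and>
     (\<forall>x r M. 0 < r \<and> cball x r \<subseteq> D \<and> 0 \<le> M \<longrightarrow>
        truncation M u x
          \<le> K / (measure lebesgue (ball (0::'a) 1) * r ^ DIM('a))
              * (LINT z:ball x r|lebesgue. truncation M u z))"

definition quasi_nearly_subharmonic :: "'a::euclidean_space set \<Rightarrow> ('a \<Rightarrow> ereal) \<Rightarrow> bool" where
  "quasi_nearly_subharmonic D u \<longleftrightarrow> (\<exists>K. K_quasi_nearly_subharmonic K D u)"

(* The Harnack constant C is an explicit argument because it is to depend on l only, hence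
   must be the same for all slices. The constant K above is explicit for the same purpose:
   with K allowed to vary with y, the function |y| / (|y|^2 + |x|) for |x| < 1, 0 < |y| < 1
   is quasi-nearly subharmonic in x and Harnack in y, but not quasi-nearly subharmonic. Sup and Inf are the maximum and minimum of a continuous
   function on a compact ball. For D = UNIV the same formula is used. *)
definition harnack_function ::
    "real \<Rightarrow> real \<Rightarrow> 'a::euclidean_space set \<Rightarrow> ('a \<Rightarrow> real) \<Rightarrow> bool" where
  "harnack_function l C D u \<longleftrightarrow>
     0 < l \<and> l < 1 \<and> C \<ge> 1 \<and>
     continuous_on D u \<and>
     (\<forall>z\<in>D. 0 \<le> u z) \<and>
     (\<forall>x r. 0 < r \<and> cball x r \<subseteq> D \<longrightarrow>
        (SUP z\<in>cball x (l * r). u z) \<le> C * (INF z\<in>cball x (l * r). u z))"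

end

theory Submission
  imports Defs
begin

text \<open>
  The Harnack inequality compares the values of \<open>u\<close> along each vertical slice, so on a product of
  balls \<open>ball x0 s \<times> ball y0 (l * s)\<close> whose surrounding product \<open>cball x0 s \<times> cball y0 s\<close> lies in
  \<open>\<Omega>\<close> the function \<open>u\<close> is comparable, with factor \<open>C\<close> in both directions, to
  \<open>(x, y) \<mapsto> u (x, y0)\<close>. This function of \<open>x\<close> alone is integrable over the ball around \<open>x0\<close>, hence
  so is \<open>u\<close> over the product; by compactness \<open>u\<close> is locally integrable
  (\<open>integral_rectangle_comparable\<close>, \<open>locally_integrableI\<close>).

  For the mean value inequality on \<open>ball (x0, y0) r\<close>, take \<open>s = r / 2\<close>, so that the product of balls
  lies in that ball. The inequality in the first variable bounds \<open>u (x0, y0)\<close> by \<open>K\<close> times the mean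
  of \<open>u (\<cdot>, y0)\<close> over \<open>ball x0 s\<close>; averaging \<open>u (x, y0) \<le> C * u (x, y)\<close> over \<open>y\<close> bounds this by
  \<open>K * C\<close> times the mean of \<open>u\<close> over the product, and since \<open>u\<close> is nonnegative one may enlarge the
  product to the ball at the cost of the ratio of the volumes, which does not depend on \<open>r\<close>.
  For nonnegative \<open>u\<close> the truncations only add constants and can be disregarded
  (\<open>K_quasi_nearly_subharmonic_nonneg_iff\<close>).

  Joint measurability is the Caratheodory argument: \<open>u\<close> is measurable in \<open>x\<close> and continuous in
  \<open>y\<close> (\<open>measurable_lebesgue_on_Caratheodory\<close>).
\<close>

section \<open>Lebesgue measure on a product\<close>

lemma null_sets_lborel_Times_UNIV:
  fixes N :: "'a::euclidean_space set"
  assumes N: "N \<in> null_sets lborel"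
  shows "N \<times> (UNIV :: 'b::euclidean_space set) \<in> null_sets lborel"
proof -
  have "emeasure lborel (N \<times> (UNIV :: 'b set)) = emeasure (lborel \<Otimes>\<^sub>M lborel) (N \<times> (UNIV :: 'b set))"
    by (simp add: lborel_prod)
  also have "\<dots> = 0"
    using N by (subst lborel.emeasure_pair_measure_Times) auto
  finally show "N \<times> (UNIV :: 'b set) \<in> null_sets lborel"
    using N by (auto simp: null_sets_def borel_Times)
qed

text \<open>
  Measurability of the projection between the completed measure spaces is more than Borel
  measurability: it rests on preimages of null sets being null sets.
\<close>
lemma fst_measurable_lebesgue:
  "fst \<in> (lebesgue :: ('a::euclidean_space \<times> 'b::euclidean_space) measure) \<rightarrow>\<^sub>M lebesgue"
proof (rule completion.measurable_completion2)
  show fst_borel: "fst \<in> (lebesgue :: ('a \<times> 'b) measure) \<rightarrow>\<^sub>M lborel"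
    by (intro measurable_completion) (simp add: borel_measurable_continuous_onI continuous_on_fst)
  show "null_sets lborel \<subseteq> null_sets (distr (lebesgue :: ('a \<times> 'b) measure) lborel fst)"
  proof
    fix N :: "'a set"
    assume N: "N \<in> null_sets lborel"
    then have "N \<times> (UNIV :: 'b set) \<in> null_sets lborel"
      by (rule null_sets_lborel_Times_UNIV)
    then have "fst -` N \<in> null_sets (lebesgue :: ('a \<times> 'b) measure)"
      by (simp add: null_sets_completionI vimage_fst)
    then show "N \<in> null_sets (distr (lebesgue :: ('a \<times> 'b) measure) lborel fst)"
      using N fst_borel by (auto simp: null_sets_def emeasure_distr)
  qed
qed

lemma snd_borel_measurable_lebesgue:
  "snd \<in> borel_measurable (lebesgue :: ('a::euclidean_space \<times> 'b::euclidean_space) measure)"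
  by (simp add: borel_measurable_continuous_onI measurable_completion continuous_on_snd)

lemma AE_lebesgue_fst:
  assumes "AE x in (lborel :: 'a::euclidean_space measure). P x"
  shows "AE z in (lebesgue :: ('a \<times> 'b::euclidean_space) measure). P (fst z)"
proof -
  obtain N where N: "N \<in> null_sets (lborel :: 'a measure)" "{x. \<not> P x} \<subseteq> N"
    using assms unfolding eventually_ae_filter by auto
  have "N \<times> (UNIV :: 'b set) \<in> null_sets lborel"
    using N(1) by (rule null_sets_lborel_Times_UNIV)
  then show ?thesis
    by (rule AE_I'[OF null_sets_completionI]) (use N(2) in auto)
qed

text \<open>
  Fubini's theorem is needed only for products \<open>f x * indicator B y\<close>. A Lebesgue measurable \<open>f\<close> is
  replaced by a Borel function equal to it almost everywhere, which reduces the claim to the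
  product of the uncompleted measures.
\<close>
lemma has_bochner_integral_lebesgue_strip:
  fixes f :: "'a::euclidean_space \<Rightarrow> real" and B :: "'b::euclidean_space set"
  assumes f: "integrable lebesgue f" and B: "B \<in> sets borel" "emeasure lborel B < \<infinity>"
  shows "has_bochner_integral lebesgue (\<lambda>z. indicator B (snd z) * f (fst z))
           (measure lebesgue B * integral\<^sup>L lebesgue f)"
proof -
  obtain f' where f'[measurable]: "f' \<in> borel_measurable lborel"
    and ae: "AE x in lborel. f x = f' x"
    using completion_ex_borel_measurable_real[OF borel_measurable_integrable[OF f]] by blast
  have f'_leb: "f' \<in> borel_measurable lebesgue"
    using f' by (rule measurable_completion)
  have "integrable lebesgue f'"
    using f f'_leb AE_completion[OF ae] by (rule integrable_cong_AE_imp)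
  then have int_f': "integrable lborel f'"
    using f' integrable_completion by blast
  have int_eq: "integral\<^sup>L lborel f' = integral\<^sup>L lebesgue f"
    using integral_cong_AE[OF borel_measurable_integrable[OF f] f'_leb AE_completion[OF ae]]
      integral_completion[OF f'] by simp
  define h :: "'a \<times> 'b \<Rightarrow> real" where "h z = indicator B (snd z) * f' (fst z)" for z
  have B'[measurable]: "B \<in> sets lborel"
    using B by simp
  have h[measurable]: "h \<in> borel_measurable (lborel \<Otimes>\<^sub>M lborel)"
    unfolding h_def by measurable
  have section_int: "integrable lborel (\<lambda>y. indicator B y * c)" for c :: real
    using B by (intro integrable_mult_left integrable_real_indicator) auto
  have section_val: "(\<integral>y. indicator B y * c \<partial>lborel) = measure lborel B * c" for c :: real
    using B by simp
  have h_int: "integrable (lborel \<Otimes>\<^sub>M lborel) h"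
  proof (rule lborel_pair.Fubini_integrable[OF h])
    have "(\<lambda>x. \<integral>y. norm (h (x, y)) \<partial>lborel) = (\<lambda>x. measure lborel B * \<bar>f' x\<bar>)"
      by (simp add: h_def abs_mult section_val)
    then show "integrable lborel (\<lambda>x. \<integral>y. norm (h (x, y)) \<partial>lborel)"
      using int_f' by simp
    show "AE x in lborel. integrable lborel (\<lambda>y. h (x, y))"
      unfolding h_def fst_conv snd_conv by (intro AE_I2 section_int)
  qed
  have "integral\<^sup>L (lborel \<Otimes>\<^sub>M lborel) h = (\<integral>x. \<integral>y. h (x, y) \<partial>lborel \<partial>lborel)"
    using lborel_pair.integral_fst'[OF h_int] by simp
  also have "\<dots> = measure lborel B * integral\<^sup>L lebesgue f"
    by (simp add: h_def section_val int_eq)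
  finally have h_val: "integral\<^sup>L (lborel \<Otimes>\<^sub>M lborel) h = measure lebesgue B * integral\<^sup>L lebesgue f"
    using B by (simp add: measure_completion)
  have "has_bochner_integral lebesgue h (measure lebesgue B * integral\<^sup>L lebesgue f)"
    using h_int h_val h
    by (simp add: lborel_prod has_bochner_integral_iff integrable_completion integral_completion)
  moreover have "(\<lambda>z. indicator B (snd z) * f (fst z)) \<in> borel_measurable (lebesgue :: ('a \<times> 'b) measure)"
    using B
    by (intro borel_measurable_times measurable_compose[OF snd_borel_measurable_lebesgue]
        measurable_compose[OF fst_measurable_lebesgue borel_measurable_integrable[OF f]]) auto
  moreover have "AE z in (lebesgue :: ('a \<times> 'b) measure). indicator B (snd z) * f (fst z) = h z"
    using AE_lebesgue_fst[OF ae] by eventually_elim (simp add: h_def)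
  ultimately show ?thesis
    using has_bochner_integral_cong_AE[of "\<lambda>z. indicator B (snd z) * f (fst z)" lebesgue h]
    by (simp add: borel_measurable_has_bochner_integral)
qed

text \<open>
  A function that is Lebesgue measurable in the first and continuous in the second variable is
  jointly Lebesgue measurable: it is the pointwise limit of \<open>u (x, F i y)\<close>, where \<open>F i\<close> are simple
  functions converging to the identity. Since \<open>\<Omega>\<close> need not be a product, \<open>(x, F i y)\<close> may lie outside
  \<open>\<Omega>\<close>, so \<open>u\<close> is extended by zero; openness of the slices puts \<open>(x, F i y)\<close> in \<open>\<Omega>\<close> for large \<open>i\<close>.
\<close>
lemma measurable_lebesgue_on_Caratheodory:
  fixes u :: "'a::euclidean_space \<times> 'b::euclidean_space \<Rightarrow> real"
  assumes \<Omega>: "open \<Omega>"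
    and meas: "\<And>y. (\<lambda>x. u (x, y)) \<in> borel_measurable (lebesgue_on {x. (x, y) \<in> \<Omega>})"
    and cont: "\<And>x. continuous_on {y. (x, y) \<in> \<Omega>} (\<lambda>y. u (x, y))"
  shows "u \<in> borel_measurable (lebesgue_on \<Omega>)"
proof -
  define g where "g z = (if z \<in> \<Omega> then u z else 0)" for z
  have slice: "open {x. (x, y) \<in> \<Omega>}" "open {y. (x, y) \<in> \<Omega>}" for x y
    using open_vimage[OF \<Omega>, of "\<lambda>x. (x, y)"] open_vimage[OF \<Omega>, of "\<lambda>y. (x, y)"]
    by (simp_all add: vimage_def continuous_on_Pair)
  have g_meas: "(\<lambda>x. g (x, q)) \<in> borel_measurable lebesgue" for q
    using borel_measurable_if_I[OF meas[of q]] slice(1)[of q]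
    by (simp add: g_def[abs_def])
  obtain F :: "nat \<Rightarrow> 'b \<Rightarrow> 'b" where F: "\<And>i. simple_function borel (F i)"
    and F_lim: "\<And>y. (\<lambda>i. F i y) \<longlonglongrightarrow> y"
    using borel_measurable_implies_sequence_metric[of "\<lambda>y::'b. y" borel 0] by auto
  define v where "v i z = indicator \<Omega> z * (\<Sum>q\<in>range (F i). indicator (F i -` {q}) (snd z) * g (fst z, q))"
    for i and z :: "'a \<times> 'b"
  have fin: "finite (range (F i))" for i
    using simple_functionD(1)[OF F[of i]] by simp
  have v_eq: "v i (x, y) = indicator \<Omega> (x, y) * g (x, F i y)" for i x y
  proof -
    have "(\<Sum>q\<in>range (F i). indicator (F i -` {q}) y * g (x, q))
        = (\<Sum>q\<in>range (F i). if q = F i y then g (x, q) else 0)"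
      by (intro sum.cong) (auto simp: indicator_def)
    also have "\<dots> = g (x, F i y)"
      using fin[of i] by (simp add: sum.delta)
    finally show ?thesis
      by (simp add: v_def)
  qed
  have "v i \<in> borel_measurable lebesgue" for i
  proof -
    have "F i -` {q} \<in> sets borel" for q
      using simple_functionD(2)[OF F[of i], of "{q}"] by simp
    then have "(\<lambda>z. indicator (F i -` {q}) (snd z) :: real) \<in> borel_measurable (lebesgue :: ('a \<times> 'b) measure)" for q
      by (intro measurable_compose[OF snd_borel_measurable_lebesgue] borel_measurable_indicator)
    moreover have "(\<lambda>z. g (fst z, q)) \<in> borel_measurable (lebesgue :: ('a \<times> 'b) measure)" for q
      using measurable_compose[OF fst_measurable_lebesgue g_meas] .
    moreover have "(indicator \<Omega> :: _ \<Rightarrow> real) \<in> borel_measurable lebesgue"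
      using \<Omega> by (intro borel_measurable_indicator) auto
    ultimately show ?thesis
      unfolding v_def by (intro borel_measurable_times borel_measurable_sum)
  qed
  moreover have "(\<lambda>i. v i z) \<longlonglongrightarrow> g z" for z
  proof (cases z)
    case (Pair x y)
    show ?thesis
    proof (cases "(x, y) \<in> \<Omega>")
      case True
      have "isCont (\<lambda>y. u (x, y)) y"
        using cont[of x] slice(2)[of x] True by (simp add: continuous_on_eq_continuous_at)
      then have "(\<lambda>i. u (x, F i y)) \<longlonglongrightarrow> u (x, y)"
        using F_lim[of y] by (rule isCont_tendsto_compose)
      moreover have "\<forall>\<^sub>F i in sequentially. u (x, F i y) = v i z"
        using topological_tendstoD[OF F_lim[of y] slice(2)[of x]] True
        by (auto simp: Pair v_eq g_def elim!: eventually_mono)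
      ultimately show ?thesis
        using True by (auto simp: Pair g_def intro: Lim_transform_eventually)
    qed (simp add: Pair v_eq g_def)
  qed
  ultimately have "g \<in> borel_measurable lebesgue"
    by (rule borel_measurable_LIMSEQ_real[rotated])
  then show ?thesis
    unfolding g_def[abs_def] by (rule borel_measurable_if_D)
qed

text \<open>
  In the application \<open>g x = u (x, y0)\<close>, and the two pointwise bounds are Harnack's inequality.
\<close>
lemma integral_rectangle_comparable:
  fixes u :: "'a::euclidean_space \<times> 'b::euclidean_space \<Rightarrow> real"
  assumes A: "A \<in> sets borel" and B: "B \<in> sets borel" "emeasure lborel B < \<infinity>"
    and u: "u \<in> borel_measurable (lebesgue_on (A \<times> B))" "\<And>z. z \<in> A \<times> B \<Longrightarrow> 0 \<le> u z"
    and g: "g absolutely_integrable_on A"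
    and upper: "\<And>x y. x \<in> A \<Longrightarrow> y \<in> B \<Longrightarrow> u (x, y) \<le> C * g x"
    and lower: "\<And>x y. x \<in> A \<Longrightarrow> y \<in> B \<Longrightarrow> g x \<le> C * u (x, y)"
  shows "u absolutely_integrable_on (A \<times> B)"
    and "measure lebesgue B * (LINT x:A|lebesgue. g x) \<le> C * (LINT z:A \<times> B|lebesgue. u z)"
proof -
  have AB: "A \<times> B \<in> sets lebesgue"
    using A B by (simp add: borel_Times)
  have "has_bochner_integral lebesgue (\<lambda>z. indicator B (snd z) * (indicator A (fst z) * g (fst z)))
      (measure lebesgue B * (LINT x:A|lebesgue. g x))"
    using has_bochner_integral_lebesgue_strip[OF _ B, of "\<lambda>x. indicator A x * g x"] g
    by (simp add: set_integrable_def set_lebesgue_integral_def)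
  moreover have "(\<lambda>z. indicator B (snd z) * (indicator A (fst z) * g (fst z)))
      = (\<lambda>z. indicator (A \<times> B) z *\<^sub>R g (fst z))"
    by (auto simp: indicator_def fun_eq_iff)
  ultimately have g_int: "(\<lambda>z. g (fst z)) absolutely_integrable_on (A \<times> B)"
    and g_val: "(LINT z:A \<times> B|lebesgue. g (fst z)) = measure lebesgue B * (LINT x:A|lebesgue. g x)"
    by (simp_all add: set_integrable_def set_lebesgue_integral_def has_bochner_integral_iff)
  show u_int: "u absolutely_integrable_on (A \<times> B)"
  proof (rule set_integrable_bound)
    show "(\<lambda>z. C * g (fst z)) absolutely_integrable_on (A \<times> B)"
      using g_int by simp
    show "set_borel_measurable lebesgue (A \<times> B) u"
      using borel_measurable_if_I[OF u(1) AB]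
      unfolding set_borel_measurable_def indicator_scaleR_eq_if .
    show "AE z in lebesgue. z \<in> A \<times> B \<longrightarrow> norm (u z) \<le> norm (C * g (fst z))"
      using u(2) upper by (intro AE_I2) force
  qed
  have "(LINT z:A \<times> B|lebesgue. g (fst z)) \<le> (LINT z:A \<times> B|lebesgue. C * u z)"
    using g_int u_int lower by (intro set_integral_mono) auto
  then show "measure lebesgue B * (LINT x:A|lebesgue. g x) \<le> C * (LINT z:A \<times> B|lebesgue. u z)"
    by (simp add: g_val)
qed

section \<open>Nonnegative quasi-nearly subharmonic functions and Harnack functions\<close>

lemma locally_integrable_cong:
  assumes "\<And>z. z \<in> D \<Longrightarrow> f z = g z"
  shows "locally_integrable D f \<longleftrightarrow> locally_integrable D g"
proof -
  have "f absolutely_integrable_on S \<longleftrightarrow> g absolutely_integrable_on S" if "S \<subseteq> D" for S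
    unfolding set_integrable_def using assms that
    by (intro arg_cong[where f="integrable lebesgue"] ext) (auto simp: indicator_def)
  then show ?thesis
    unfolding locally_integrable_def by blast
qed

text \<open>
  For nonnegative \<open>u\<close> the truncation at level \<open>M\<close> is \<open>u + M\<close>, so the inequality for \<open>M = 0\<close> implies
  all the others because \<open>K \<ge> 1\<close>.
\<close>
lemma K_quasi_nearly_subharmonic_nonneg_iff:
  fixes u :: "'a::euclidean_space \<Rightarrow> real"
  assumes nonneg: "\<And>z. z \<in> D \<Longrightarrow> 0 \<le> u z"
  shows "K_quasi_nearly_subharmonic K D (\<lambda>z. ereal (u z)) \<longleftrightarrow>
     K \<ge> 1 \<and> u \<in> borel_measurable (lebesgue_on D) \<and> locally_integrable D u \<and>
     (\<forall>x r. 0 < r \<and> cball x r \<subseteq> D \<longrightarrow>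
        u x \<le> K / (measure lebesgue (ball (0::'a) 1) * r ^ DIM('a)) * (LINT z:ball x r|lebesgue. u z))"
    (is "_ \<longleftrightarrow> _ \<and> _ \<and> _ \<and> ?mean")
proof -
  let ?V = "\<lambda>r. measure lebesgue (ball (0::'a) 1) * r ^ DIM('a)"
  have trunc: "truncation M (\<lambda>z. ereal (u z)) z = u z + M" if "z \<in> D" "0 \<le> M" for M z
    using nonneg[OF that(1)] that(2) by (simp add: truncation_def max_def)
  have loc: "locally_integrable D (\<lambda>z. real_of_ereal (max (ereal (u z)) 0)) \<longleftrightarrow> locally_integrable D u"
    using nonneg by (intro locally_integrable_cong) (simp add: max_absorb1)
  have step: "truncation M (\<lambda>z. ereal (u z)) x \<le> K / ?V r * (LINT z:ball x r|lebesgue. truncation M (\<lambda>z. ereal (u z)) z)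
      \<longleftrightarrow> u x + M \<le> K / ?V r * (LINT z:ball x r|lebesgue. u z) + K * M"
    if loc_u: "locally_integrable D u" and r: "0 < r" "cball x r \<subseteq> D" and M: "0 \<le> M" for x r M
  proof -
    have sub: "ball x r \<subseteq> cball x r"
      by (rule ball_subset_cball)
    have "u absolutely_integrable_on cball x r"
      using loc_u r(2) by (simp add: locally_integrable_def)
    then have u_int: "u absolutely_integrable_on ball x r"
      by (rule set_integrable_subset) auto
    have M_int: "(\<lambda>z. M) absolutely_integrable_on ball x r"
      by (simp add: absolutely_integrable_on_const)
    have vol: "measure lebesgue (ball x r) = ?V r" "?V r > 0"
      using r(1) content_ball_conv_unit_ball[of r x] content_ball_pos[of 1 "0::'a"] by auto
    have "(LINT z:ball x r|lebesgue. truncation M (\<lambda>z. ereal (u z)) z) = (LINT z:ball x r|lebesgue. u z + M)"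
      using sub r(2) M by (intro set_lebesgue_integral_cong) (auto simp: trunc subset_iff)
    also have "\<dots> = (LINT z:ball x r|lebesgue. u z) + ?V r * M"
      using set_integral_add(2)[OF u_int M_int] vol
      by (simp add: set_lebesgue_integral_def)
    finally have "K / ?V r * (LINT z:ball x r|lebesgue. truncation M (\<lambda>z. ereal (u z)) z)
        = K / ?V r * (LINT z:ball x r|lebesgue. u z) + K * M"
      using vol(2) r(1) by (simp add: distrib_left)
    moreover have "x \<in> D"
      using r by auto
    ultimately show ?thesis
      using M by (simp add: trunc)
  qed
  have "(\<forall>x r M. 0 < r \<and> cball x r \<subseteq> D \<and> 0 \<le> M \<longrightarrow>
        truncation M (\<lambda>z. ereal (u z)) x \<le> K / ?V r * (LINT z:ball x r|lebesgue. truncation M (\<lambda>z. ereal (u z)) z))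
      \<longleftrightarrow> ?mean" (is "?trunc_mean \<longleftrightarrow> _") if K: "K \<ge> 1" and loc_u: "locally_integrable D u"
  proof
    assume trunc_mean: ?trunc_mean
    show ?mean
    proof (intro allI impI, elim conjE)
      fix x r
      assume r: "0 < r" "cball x r \<subseteq> D"
      then show "u x \<le> K / ?V r * (LINT z:ball x r|lebesgue. u z)"
        using step[OF loc_u r order_refl] trunc_mean[rule_format, of r x 0] by simp
    qed
  next
    assume mean: ?mean
    show ?trunc_mean
    proof (intro allI impI, elim conjE)
      fix x r and M :: real
      assume r: "0 < r" "cball x r \<subseteq> D" and M: "0 \<le> M"
      have "M \<le> K * M"
        using mult_right_mono[OF K M] by simp
      then have "u x + M \<le> K / ?V r * (LINT z:ball x r|lebesgue. u z) + K * M"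
        using mean[rule_format, of r x] r by (intro add_mono) auto
      then show "truncation M (\<lambda>z. ereal (u z)) x
          \<le> K / ?V r * (LINT z:ball x r|lebesgue. truncation M (\<lambda>z. ereal (u z)) z)"
        by (rule iffD2[OF step[OF loc_u r M]])
    qed
  qed
  then show ?thesis
    unfolding K_quasi_nearly_subharmonic_def by (auto simp: loc)
qed

lemma harnack_function_le:
  assumes u: "harnack_function l C D u" and r: "0 < r" "cball x r \<subseteq> D"
    and zw: "z \<in> cball x (l * r)" "w \<in> cball x (l * r)"
  shows "u z \<le> C * u w"
proof -
  let ?B = "cball x (l * r)"
  have l: "0 < l" "l < 1" and C: "C \<ge> 1"
    using u by (auto simp: harnack_function_def)
  have "l * r \<le> r"
    using l r(1) by simp
  then have sub: "?B \<subseteq> D"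
    using r(2) subset_cball by blast
  then have "compact (u ` ?B)"
    using u continuous_on_subset
    by (auto simp: harnack_function_def intro!: compact_continuous_image)
  then have bdd: "bdd_above (u ` ?B)" "bdd_below (u ` ?B)"
    by (auto intro: bounded_imp_bdd_above bounded_imp_bdd_below compact_imp_bounded)
  have "u z \<le> (SUP z\<in>?B. u z)"
    using bdd(1) zw(1) by (rule cSUP_upper[rotated])
  also have "\<dots> \<le> C * (INF z\<in>?B. u z)"
    using u r by (auto simp: harnack_function_def)
  also have "\<dots> \<le> C * u w"
    using bdd(2) zw(2) C by (intro mult_left_mono cINF_lower) auto
  finally show ?thesis .
qed

section \<open>Separately quasi-nearly subharmonic and Harnack functions\<close>

lemma cball_times_subset:
  assumes "cball (x, y) r \<subseteq> \<Omega>"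
  shows "cball x (r / 2) \<times> cball y (r / 2) \<subseteq> \<Omega>"
proof -
  have "(x', y') \<in> cball (x, y) r" if "dist x x' \<le> r / 2" "dist y y' \<le> r / 2" for x' y'
    using that sqrt_sum_squares_le_sum[of "dist x x'" "dist y y'"] by (simp add: dist_Pair_Pair)
  then show ?thesis
    using assms by auto
qed

lemma locally_integrableI:
  fixes f :: "'a::euclidean_space \<Rightarrow> real"
  assumes local: "\<And>z. z \<in> D \<Longrightarrow> \<exists>U. open U \<and> z \<in> U \<and> f absolutely_integrable_on U"
  shows "locally_integrable D f"
  unfolding locally_integrable_def
proof (intro allI impI, elim conjE)
  fix S
  assume S: "compact S" "S \<subseteq> D"
  obtain U where U: "\<And>z. z \<in> D \<Longrightarrow> open (U z) \<and> z \<in> U z \<and> f absolutely_integrable_on U z"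
    using local by metis
  obtain Z where Z: "Z \<subseteq> S" "finite Z" "S \<subseteq> (\<Union>z\<in>Z. U z)"
    using compactE_image[OF S(1), of S U] U S(2) by (metis UN_I subset_iff)
  have "f absolutely_integrable_on (\<Union>z\<in>Z. U z)"
    using Z(2) Z(1)
  proof (induction rule: finite_induct)
    case (insert z Z)
    then show ?case
      using U S(2) by (auto intro!: absolutely_integrable_Un)
  qed auto
  then show "f absolutely_integrable_on S"
    by (rule set_integrable_subset) (use S(1) Z(3) in \<open>auto simp: compact_imp_closed\<close>)
qed

lemma quasi_nearly_subharmonic_separately:
  fixes u :: "'a::euclidean_space \<times> 'b::euclidean_space \<Rightarrow> real"
  assumes \<Omega>: "open \<Omega>"
    and nonneg: "\<And>z. z \<in> \<Omega> \<Longrightarrow> 0 \<le> u z"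
    and qns: "\<And>y. K_quasi_nearly_subharmonic K {x. (x, y) \<in> \<Omega>} (\<lambda>x. ereal (u (x, y)))"
    and harnack: "\<And>x. harnack_function l C {y. (x, y) \<in> \<Omega>} (\<lambda>y. u (x, y))"
  shows "quasi_nearly_subharmonic \<Omega> (\<lambda>z. ereal (u z))"
proof -
  have l: "0 < l" "l < 1" and C: "C \<ge> 1" and cont: "continuous_on {y. (x, y) \<in> \<Omega>} (\<lambda>y. u (x, y))" for x
    using harnack[of x] by (auto simp: harnack_function_def)
  have K: "K \<ge> 1"
    and meas: "(\<lambda>x. u (x, y)) \<in> borel_measurable (lebesgue_on {x. (x, y) \<in> \<Omega>})"
    and loc: "locally_integrable {x. (x, y) \<in> \<Omega>} (\<lambda>x. u (x, y))"
    and mean: "\<And>x r. 0 < r \<Longrightarrow> cball x r \<subseteq> {x. (x, y) \<in> \<Omega>} \<Longrightarrow>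
        u (x, y) \<le> K / (measure lebesgue (ball (0::'a) 1) * r ^ DIM('a)) * (LINT x:ball x r|lebesgue. u (x, y))"
    for y
    using iffD1[OF K_quasi_nearly_subharmonic_nonneg_iff qns[of y]] nonneg by simp_all
  have u_meas: "u \<in> borel_measurable (lebesgue_on \<Omega>)"
    using \<Omega> meas cont by (rule measurable_lebesgue_on_Caratheodory)
  have rect: "u absolutely_integrable_on (ball x0 s \<times> ball y0 (l * s))"
    "measure lebesgue (ball y0 (l * s)) * (LINT x:ball x0 s|lebesgue. u (x, y0))
      \<le> C * (LINT z:ball x0 s \<times> ball y0 (l * s)|lebesgue. u z)"
    if s: "0 < s" and sub: "cball x0 s \<times> cball y0 s \<subseteq> \<Omega>" for x0 y0 s
  proof -
    have "l * s \<le> s" "0 \<le> l * s"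
      using l s by simp_all
    then have R: "ball x0 s \<times> ball y0 (l * s) \<subseteq> \<Omega>"
      using sub by fastforce
    have ball: "u (x, y) \<le> C * u (x, y')"
      if "x \<in> ball x0 s" "y \<in> cball y0 (l * s)" "y' \<in> cball y0 (l * s)" for x y y'
      using harnack_function_le[OF harnack s _ that(2,3), of x] sub that(1) by fastforce
    have sub': "cball x0 s \<subseteq> {x. (x, y0) \<in> \<Omega>}"
      using sub s by auto
    have "(\<lambda>x. u (x, y0)) absolutely_integrable_on cball x0 s"
      using loc[of y0] sub' by (simp add: locally_integrable_def)
    then have g: "(\<lambda>x. u (x, y0)) absolutely_integrable_on ball x0 s"
      by (rule set_integrable_subset) auto
    have u_R: "u \<in> borel_measurable (lebesgue_on (ball x0 s \<times> ball y0 (l * s)))"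
      using measurable_restrict_mono[OF u_meas R] .
    have y0: "y0 \<in> cball y0 (l * s)"
      using \<open>0 \<le> l * s\<close> by simp
    note * = integral_rectangle_comparable[OF _ _ _ u_R _ g, of C]
    show "u absolutely_integrable_on (ball x0 s \<times> ball y0 (l * s))"
      by (rule *(1)) (use R nonneg ball y0 emeasure_lborel_ball_finite in auto)
    show "measure lebesgue (ball y0 (l * s)) * (LINT x:ball x0 s|lebesgue. u (x, y0))
      \<le> C * (LINT z:ball x0 s \<times> ball y0 (l * s)|lebesgue. u z)"
      by (rule *(2)) (use R nonneg ball y0 emeasure_lborel_ball_finite in auto)
  qed
  have u_loc: "locally_integrable \<Omega> u"
  proof (rule locally_integrableI)
    fix z
    assume z: "z \<in> \<Omega>"
    obtain r where r: "0 < r" "cball z r \<subseteq> \<Omega>"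
      using \<Omega> z open_contains_cball by blast
    obtain x y where xy: "z = (x, y)"
      by fastforce
    have "u absolutely_integrable_on (ball x (r/2) \<times> ball y (l * (r/2)))"
      using r cball_times_subset[of x y r \<Omega>] by (intro rect) (auto simp: xy)
    then show "\<exists>U. open U \<and> z \<in> U \<and> u absolutely_integrable_on U"
      using r l by (intro exI[of _ "ball x (r/2) \<times> ball y (l * (r/2))"]) (auto simp: xy open_Times)
  qed
  let ?a = "measure lebesgue (ball (0::'a) 1)" and ?b = "measure lebesgue (ball (0::'b) 1)"
    and ?c = "measure lebesgue (ball (0::'a \<times> 'b) 1)"
  have pos: "?a > 0" "?b > 0" "?c > 0"
    by (simp_all add: content_ball_pos)
  \<comment> \<open>\<open>K * C\<close> times the volume of \<open>ball z0 r\<close> divided by that of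
    \<open>ball x0 (r/2) \<times> ball y0 (l * r/2)\<close>\<close>
  define K' where "K' = K * C * ?c * 2 ^ DIM('a) * 2 ^ DIM('b) / (?a * ?b * l ^ DIM('b))"
  have mean': "u z0 \<le> max 1 K' / (?c * r ^ DIM('a \<times> 'b)) * (LINT z:ball z0 r|lebesgue. u z)"
    if r: "0 < r" "cball z0 r \<subseteq> \<Omega>" for z0 r
  proof -
    obtain x0 y0 where z0: "z0 = (x0, y0)"
      by fastforce
    let ?s = "r / 2"
    let ?R = "ball x0 ?s \<times> ball y0 (l * ?s)"
    let ?I = "LINT z:ball z0 r|lebesgue. u z"
    have s: "0 < ?s" "cball x0 ?s \<times> cball y0 ?s \<subseteq> \<Omega>"
      using r cball_times_subset[of x0 y0 r \<Omega>] by (auto simp: z0)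
    have R: "?R \<subseteq> ball z0 r"
    proof
      fix z
      assume "z \<in> ?R"
      then have "dist x0 (fst z) < r / 2" "dist y0 (snd z) < l * (r / 2)"
        by auto
      moreover have "l * (r / 2) \<le> r / 2"
        using l r by simp
      ultimately show "z \<in> ball z0 r"
        using sqrt_sum_squares_le_sum[of "dist x0 (fst z)" "dist y0 (snd z)"]
        by (cases z) (simp add: z0 dist_Pair_Pair)
    qed
    have "u absolutely_integrable_on cball z0 r"
      using u_loc r(2) by (simp add: locally_integrable_def)
    then have u_int: "u absolutely_integrable_on ball z0 r"
      by (rule set_integrable_subset) auto
    have ball_\<Omega>: "ball z0 r \<subseteq> \<Omega>"
      using r(2) ball_subset_cball by blast
    have I_R: "(LINT z:?R|lebesgue. u z) \<le> ?I"
      unfolding set_lebesgue_integral_def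
      using rect(1)[OF s] u_int R ball_\<Omega> nonneg
      by (intro integral_mono) (auto simp: set_integrable_def indicator_def subset_iff)
    have I_nonneg: "0 \<le> ?I"
      unfolding set_lebesgue_integral_def
      using ball_\<Omega> nonneg by (intro integral_nonneg_AE AE_I2) (auto simp: indicator_def subset_iff)
    have vol: "measure lebesgue (ball y0 (l * ?s)) = (l * ?s) ^ DIM('b) * ?b"
      using content_ball_conv_unit_ball[of "l * ?s" y0] l r by simp
    have "((l * ?s) ^ DIM('b) * ?b) * (LINT x:ball x0 ?s|lebesgue. u (x, y0))
        \<le> C * (LINT z:?R|lebesgue. u z)"
      using rect(2)[OF s] unfolding vol .
    also have "\<dots> \<le> C * ?I"
      using I_R C by (intro mult_left_mono) auto
    finally have J: "(LINT x:ball x0 ?s|lebesgue. u (x, y0)) \<le> C * ?I / ((l * ?s) ^ DIM('b) * ?b)"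
      using pos l r by (simp add: pos_le_divide_eq mult.commute)
    have "u z0 \<le> K / (?a * ?s ^ DIM('a)) * (LINT x:ball x0 ?s|lebesgue. u (x, y0))"
      unfolding z0 using s by (intro mean) force+
    also have "\<dots> \<le> K / (?a * ?s ^ DIM('a)) * (C * ?I / ((l * ?s) ^ DIM('b) * ?b))"
      using J K pos r by (intro mult_left_mono) auto
    also have "\<dots> = K' / (?c * r ^ DIM('a \<times> 'b)) * ?I"
      using pos l r by (simp add: K'_def power_divide power_mult_distrib power_add field_simps)
    also have "\<dots> \<le> max 1 K' / (?c * r ^ DIM('a \<times> 'b)) * ?I"
      using pos r I_nonneg by (intro mult_right_mono divide_right_mono) auto
    finally show ?thesis .
  qed
  show ?thesis
    unfolding quasi_nearly_subharmonic_def
    using nonneg u_meas u_loc mean'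
    by (intro exI[of _ "max 1 K'"]) (simp add: K_quasi_nearly_subharmonic_nonneg_iff)
qed

theorem theorem3:
  fixes \<Omega> :: "((real ^ 'm) \<times> (real ^ 'n)) set"
    and u :: "(real ^ 'm) \<times> (real ^ 'n) \<Rightarrow> real"
    and K l C :: real
  assumes "CARD('m) \<ge> 2" and "CARD('n) \<ge> 2"
    and "open \<Omega>" and "connected \<Omega>" and "\<Omega> \<noteq> {}"
    and "\<And>z. z \<in> \<Omega> \<Longrightarrow> 0 \<le> u z"
    and "\<And>y. K_quasi_nearly_subharmonic K {x. (x, y) \<in> \<Omega>} (\<lambda>x. ereal (u (x, y)))"
    and "0 < l" and "l < 1"
    and "\<And>x. harnack_function l C {y. (x, y) \<in> \<Omega>} (\<lambda>y. u (x, y))"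
  shows "quasi_nearly_subharmonic \<Omega> (\<lambda>z. ereal (u z))"
  using assms(3,6,7,10) by (rule quasi_nearly_subharmonic_separately)

end
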